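(* Let $\Gamma_n$ be an $n$-sided planar convex polygon circumscribed about a circle of radius $R>0$, with perimeter $L_n$ and area $A_n$. Let $A_n^\ast$ be the area of the regular $n$-sided convex polygon circumscribed about the same circle, and let $d_n=n\tan\frac{\pi}{n}$. Then for every positive integer $\alpha$, $$L_n^{2\alpha}-4^\alpha\left(d_nA_n\right)^\alpha\geq 4^\alpha\left(\tan\frac{\pi}{n}\right)^\alpha\left[A_n^\alpha-\left(A_n^\ast\right)^\alpha\right]$$ and $$\left(\frac{A_n}{R^2}\right)^{2\alpha}-d_n^\alpha\left(\frac{L_n}{2R}\right)^\alpha\geq\left(\tan\frac{\pi}{n}\right)^\alpha\left[\left(\frac{A_n}{R^2}\right)^\alpha-\left(\frac{A_n^\ast}{R^2}\right)^\alpha\right].$$ In each of the two inequalities, equality holds if and only if $\Gamma_n$ is a regular polygon.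
   Context: A convex polygon is circumscribed about a circle if every side of the polygon is tangent to the circle (the circle is the inscribed circle of the polygon). *)

theory Defs
  imports "HOL-Analysis.Analysis"
begin

(* A polygon is given by the cyclic list of its vertices; indices are read modulo its length,
   so the side starting at the last vertex returns to the first one. *)
definition vertex :: "(real^2) list \<Rightarrow> nat \<Rightarrow> real^2" where
  "vertex P i = P ! (i mod length P)"

definition side :: "(real^2) list \<Rightarrow> nat \<Rightarrow> (real^2) set" where
  "side P i = closed_segment (vertex P i) (vertex P (Suc i))"

(* The end points of a face of dimension 1 are extreme points of the hull, so all the listed
   vertices are proper vertices (no angle of size pi); being at least three distinct ones,
   they span the plane. *)
definition convex_polygon :: "(real^2) list \<Rightarrow> bool" where
  "convex_polygon P \<longleftrightarrow>
     3 \<le> length P \<and> distinct P \<and> (\<forall>i<length P. side P i edge_of convex hull (set P))"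

definition perimeter :: "(real^2) list \<Rightarrow> real" where
  "perimeter P = (\<Sum>i<length P. dist (vertex P i) (vertex P (Suc i)))"

definition area :: "(real^2) list \<Rightarrow> real" where
  "area P = measure lborel (convex hull (set P))"

(* The line through the side meets the circle in exactly one point, and this point of tangency
   lies on the side itself, not just on its extension. *)
definition circumscribed_about :: "(real^2) list \<Rightarrow> real^2 \<Rightarrow> real \<Rightarrow> bool" where
  "circumscribed_about P c R \<longleftrightarrow>
     (\<forall>i<length P. \<exists>p\<in>side P i. affine hull (side P i) \<inter> sphere c R = {p})"

(* The angle at vertex i + 1 between the two sides meeting there; in a convex polygon interior
   angles are less than pi, so the unoriented angle is the interior one. *)
definition interior_angle :: "(real^2) list \<Rightarrow> nat \<Rightarrow> real" where
  "interior_angle P i =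
     (let u = vertex P i - vertex P (Suc i); w = vertex P (Suc (Suc i)) - vertex P (Suc i)
      in arccos ((u \<bullet> w) / (norm u * norm w)))"

definition regular_polygon :: "(real^2) list \<Rightarrow> bool" where
  "regular_polygon P \<longleftrightarrow>
     convex_polygon P \<and>
     (\<forall>i<length P. \<forall>j<length P.
        dist (vertex P i) (vertex P (Suc i)) = dist (vertex P j) (vertex P (Suc j)) \<and>
        interior_angle P i = interior_angle P j)"

end

(*
  Every side is R away from the centre, so cutting the polygon into the triangles spanned by the
  centre and the sides gives A = R L / 2.  With 2 theta_i the angle between the tangent points next
  to the i-th vertex, L = 2 R sum_i tan(theta_i) and sum_i theta_i = pi, so Jensen's inequality for
  tan gives L >= 2 R d, with equality exactly when all theta_i agree, i.e. for regular polygons.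
  In terms of t = L / (2 R) = A / R^2 both inequalities read
    (t^alpha - d^alpha) (t^alpha - tan(pi/n)^alpha) >= 0,   where t >= d > tan(pi/n).
*)
theory Submission
  imports Defs
begin


text \<open>That the angles sum to pi hides most of the work. \<open>convex_polygon\<close> says
  only that every side is an edge of the hull; that the circle lies on the inner side of each side
  line, that all sides are traversed in the same sense, and that the list goes round exactly once
  has to be derived. A closed chain of tangents may turn more often: a pentagram turns through 4 pi.
  It is excluded because vertices off a side lie strictly on the inner side of its line. Relative to
  the unit normal of a side, the vertex after it has argument \<theta> and the vertex before it -
  \<theta>, each with its own \<theta>; hence consecutive normals differ by twice the \<theta> of
  their common vertex. That there is just one turn also lets the sectors at the centre cover the
  plane once, which the dissection into triangles needs.\<close>

section \<open>Turning angles and sectors of a chain of tangents\<close>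

text \<open>The addition theorem for \<open>sin (\<theta> - x)\<close> expresses an inner direction
  of a sector by its two boundary directions, with coefficients that are nonnegative sines.\<close>

lemma cis_cone:
  assumes "0 < \<theta>" "\<theta> < pi / 2" "0 \<le> x" "x \<le> \<theta>" "0 \<le> r"
  obtains a b where "0 \<le> a" "0 \<le> b"
    "complex_of_real r * cis (\<phi> + x) = of_real a * cis \<phi> + of_real b * cis (\<phi> + \<theta>)"
proof -
  have s: "0 < sin \<theta>" using assms by (intro sin_gt_zero) auto
  have s1: "0 \<le> sin (\<theta> - x)" "0 \<le> sin x" using assms by (auto intro!: sin_ge_zero)
  have id: "sin \<theta> *\<^sub>R cis x = sin (\<theta> - x) *\<^sub>R 1 + sin x *\<^sub>R cis \<theta>"
    by (simp add: complex_eq_iff sin_diff)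
  have "cis x = complex_of_real (sin (\<theta> - x) / sin \<theta>) + of_real (sin x / sin \<theta>) * cis \<theta>"
    using id s by (simp add: scaleR_conv_of_real field_simps)
  then have "complex_of_real r * cis (\<phi> + x) = of_real (r * (sin (\<theta> - x) / sin \<theta>)) * cis \<phi>
      + of_real (r * (sin x / sin \<theta>)) * cis (\<phi> + \<theta>)"
    by (simp add: cis_mult[symmetric] algebra_simps)
  then show thesis using that s s1 assms(5) by (meson divide_nonneg_pos mult_nonneg_nonneg)
qed

lemma partial_sum_bracket:
  fixes \<phi> :: "nat \<Rightarrow> real"
  assumes "\<phi> 0 \<le> x" "x < \<phi> n"
  obtains j where "j < n" "\<phi> j \<le> x" "x < \<phi> (Suc j)"
proof -
  define k where "k = (LEAST k. x < \<phi> k)"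
  have k: "x < \<phi> k" unfolding k_def using assms(2) by (rule LeastI)
  then have "k \<noteq> 0" using assms(1) by (metis not_less)
  then obtain j where j: "k = Suc j" by (cases k) auto
  have "\<phi> j \<le> x" using not_less_Least[of j "\<lambda>k. x < \<phi> k"] j unfolding k_def by (metis lessI not_less)
  moreover have "k \<le> n" unfolding k_def using assms(2) by (rule Least_le)
  ultimately show thesis using that[of j] k j by auto
qed

text \<open>Here \<open>u i\<close> is the direction of the tangent point of side \<open>i\<close>, and \<open>\<theta> i\<close> is half the angle between the
  tangent directions of the two sides at vertex \<open>i\<close>, which therefore lies at
  \<open>u i * cis (- \<theta> i) / cos (\<theta> i)\<close> when the circle is the unit circle.\<close>
locale tangent_chain =
  fixes n :: nat and u :: "nat \<Rightarrow> complex" and \<theta> :: "nat \<Rightarrow> real"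
  assumes n_gt_2: "2 < n"
    and u0: "norm (u 0) = 1"
    and u_Suc: "u (Suc i) = u i * cis (2 * \<theta> (Suc i))"
    and angle: "0 < \<theta> i" "\<theta> i < pi / 2"
    and u_closed: "u n = u 0"
    and convex: "2 \<le> j \<Longrightarrow> j < n \<Longrightarrow> Re (u j * cis (- \<theta> j) * cnj (u 0)) < cos (\<theta> j)"
begin

text \<open>The angle from \<open>u 0\<close> to \<open>u i\<close>. The shift to
  \<open>Suc k\<close> reflects that vertex \<open>Suc k\<close> is the one between sides
  \<open>k\<close> and \<open>Suc k\<close>.\<close>

definition \<phi> :: "nat \<Rightarrow> real" where "\<phi> i = 2 * (\<Sum>k<i. \<theta> (Suc k))"

lemma \<phi>_0: "\<phi> 0 = 0" and \<phi>_Suc: "\<phi> (Suc i) = \<phi> i + 2 * \<theta> (Suc i)"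
  by (simp_all add: \<phi>_def)

lemma u_eq: "u i = u 0 * cis (\<phi> i)"
  by (induction i) (simp_all add: \<phi>_0 \<phi>_Suc u_Suc cis_mult)

text \<open>The total turning is a multiple of \<open>2 * pi\<close>. If it were not the smallest one, some vertex \<open>i\<close>
  with \<open>2 \<le> i < n\<close> would see, after one full turn, the first tangent direction between its own two
  tangent directions, and so would lie on or beyond the first side line.\<close>
lemma total_turning: "\<phi> n = 2 * pi"
proof -
  have u0': "u 0 \<noteq> 0" using u0 by auto
  have "cis (\<phi> n) = 1" using u_eq[of n] u_closed u0' by simp
  then have "cos (\<phi> n) = 1" by (metis cis.sel(1) one_complex.sel(1))
  then obtain k :: int where k: "\<phi> n = k * 2 * pi" by (auto simp: cos_one_2pi_int)
  have pos: "0 < \<phi> n" unfolding \<phi>_def using angle(1) n_gt_2 by (auto intro!: sum_pos)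
  then have k1: "1 \<le> k" using k by (simp add: zero_less_mult_iff)
  have "\<not> 2 \<le> k"
  proof
    assume "2 \<le> k"
    then have "2 * (2 * pi) \<le> k * (2 * pi)" by (intro mult_right_mono) auto
    then have "2 * pi < \<phi> n" using k pi_gt_zero by (simp add: mult.assoc)
    then obtain j where j: "j < n" "\<phi> j \<le> 2 * pi" "2 * pi < \<phi> (Suc j)"
      using partial_sum_bracket[of \<phi> "2*pi" n] \<phi>_0 by auto
    \<comment> \<open>Relative to \<open>u 0\<close>, vertex \<open>i\<close> has direction
      \<open>\<phi> i - \<theta> i\<close>; the two bounds place it within \<open>\<theta> i\<close>
      of a full turn.\<close>
    have big: "cos (\<theta> i) \<le> Re (u i * cis (- \<theta> i) * cnj (u 0))"
      if "\<phi> i \<le> 2 * pi + 2 * \<theta> i" "2 * pi \<le> \<phi> i" for i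
    proof -
      have "u i * cis (- \<theta> i) * cnj (u 0) = (u 0 * cnj (u 0)) * cis (\<phi> i - \<theta> i)"
        by (subst u_eq) (simp add: cis_mult mult.assoc mult.commute mult.left_commute)
      also have "u 0 * cnj (u 0) = 1" using u0 by (metis complex_norm_square of_real_1 one_power2)
      finally have "Re (u i * cis (- \<theta> i) * cnj (u 0)) = cos (\<phi> i - \<theta> i)" by simp
      also have "\<dots> = cos (\<phi> i - \<theta> i - 2 * pi)" by (simp add: cos_diff)
      also have "\<dots> = cos \<bar>\<phi> i - \<theta> i - 2 * pi\<bar>" by simp
      also have "\<dots> \<ge> cos (\<theta> i)" using that angle[of i] by (intro cos_monotone_0_pi_le) auto
      finally show ?thesis .
    qed
    \<comment> \<open>The witness is \<open>j\<close> if the turn is complete exactly there, and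
      \<open>Suc j\<close> otherwise. \<open>Suc j = n\<close> is impossible: one step turns by less
      than pi, so it cannot lead from at most 2 pi to \<open>\<phi> n\<close>, which is at least 4
      pi.\<close>
    have "\<exists>i\<ge>2. i < n \<and> \<phi> i \<le> 2 * pi + 2 * \<theta> i \<and> 2 * pi \<le> \<phi> i"
    proof (cases "\<phi> j = 2 * pi")
      case True
      have "j \<noteq> 0" using True \<phi>_0 by (metis pi_neq_zero mult_eq_0_iff zero_neq_numeral)
      moreover have "j \<noteq> 1" using True angle[of 1] \<phi>_0 \<phi>_Suc[of 0] by (auto intro!: notI)
      ultimately have "2 \<le> j" by linarith
      then show ?thesis using True j angle[of j] by (intro exI[of _ j]) auto
    next
      case False
      have "j \<noteq> 0" using j angle[of 1] \<phi>_0 \<phi>_Suc[of 0] pi_gt_zero by (cases "j = 0") auto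
      then have "2 \<le> Suc j" by simp
      moreover have "Suc j \<noteq> n"
      proof
        assume "Suc j = n"
        then have "\<phi> n < 2 * pi + pi" using j \<phi>_Suc[of j] angle[of n] by auto
        then show False using \<open>2 * (2 * pi) \<le> k * (2 * pi)\<close> k pi_gt_zero by (simp add: mult.assoc)
      qed
      ultimately show ?thesis using j \<phi>_Suc[of j] by (intro exI[of _ "Suc j"]) auto
    qed
    then show False using big convex by (meson not_less)
  qed
  then have "k = 1" using k1 by simp
  then show ?thesis using k by simp
qed

text \<open>Normals and vertex directions alternate and go round once, so the argument of
  \<open>z\<close> falls into one of 2n sectors. The factor
  \<open>u j * cis (\<theta> (Suc j))\<close> is the direction of vertex \<open>Suc j\<close>, and
  \<open>i\<close> tells on which side of it \<open>z\<close> lies.\<close>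

lemma cover:
  fixes z :: complex
  obtains j i a b where "j < n" "i = j \<or> i = Suc j" "0 \<le> a" "0 \<le> b"
    "z = of_real a * u i + of_real b * (u j * cis (\<theta> (Suc j)))"
proof -
  have u0': "u 0 \<noteq> 0" using u0 by auto
  obtain t where t: "0 \<le> t" "t < 2 * pi" "z / u 0 = of_real (norm (z / u 0)) * cis t"
  proof -
    have "z / u 0 = of_real (norm (z / u 0)) * cis (Arg2pi (z / u 0))"
      using Arg2pi_eq[of "z / u 0"] by (simp add: cis_conv_exp)
    then show thesis using that Arg2pi_ge_0 Arg2pi_lt_2pi by blast
  qed
  define r where "r = norm (z / u 0)"
  have r: "0 \<le> r" by (simp add: r_def)
  have z: "z = u 0 * (of_real r * cis t)" using t(3) u0' by (simp add: r_def field_simps)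
  obtain j where j: "j < n" "\<phi> j \<le> t" "t < \<phi> (Suc j)"
    using partial_sum_bracket[of \<phi> t n] \<phi>_0 t(1,2) total_turning by auto
  show thesis
  proof (cases "t \<le> \<phi> j + \<theta> (Suc j)")
    case True
    obtain a b where ab: "0 \<le> a" "0 \<le> b" "of_real r * cis (\<phi> j + (t - \<phi> j)) =
        of_real a * cis (\<phi> j) + of_real b * cis (\<phi> j + \<theta> (Suc j))"
      using cis_cone[of "\<theta> (Suc j)" "t - \<phi> j" r "\<phi> j"] angle[of "Suc j"] True j r by auto
    have "z = of_real a * u j + of_real b * (u j * cis (\<theta> (Suc j)))"
      using ab(3) unfolding z u_eq[of j] by (simp add: cis_mult[symmetric] algebra_simps)
    then show thesis using that[of j j a b] j ab by auto
  next
    case False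
    \<comment> \<open>The second half sector is measured backwards from
      \<open>\<phi> (Suc j)\<close>; negated angles make \<open>cis_cone\<close> applicable, and
      conjugation undoes the reflection.\<close>
    obtain a b where ab: "0 \<le> a" "0 \<le> b" "of_real r * cis (- \<phi> (Suc j) + (\<phi> (Suc j) - t)) =
        of_real a * cis (- \<phi> (Suc j)) + of_real b * cis (- \<phi> (Suc j) + \<theta> (Suc j))"
      using cis_cone[of "\<theta> (Suc j)" "\<phi> (Suc j) - t" r "- \<phi> (Suc j)"] angle[of "Suc j"] False j r \<phi>_Suc[of j]
      by auto
    have "of_real r * cis t = of_real a * cis (\<phi> (Suc j)) + of_real b * cis (\<phi> (Suc j) - \<theta> (Suc j))"
      using arg_cong[OF ab(3), of cnj] by (simp add: cis_cnj)
    moreover have "\<phi> (Suc j) - \<theta> (Suc j) = \<phi> j + \<theta> (Suc j)" using \<phi>_Suc[of j] by simp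
    ultimately have "z = of_real a * u (Suc j) + of_real b * (u j * cis (\<theta> (Suc j)))"
      unfolding z u_eq[of j] u_eq[of "Suc j"] by (simp add: cis_mult[symmetric] algebra_simps)
    then show thesis using that[of j "Suc j" a b] j ab by auto
  qed
qed

end

section \<open>Jensen's inequality for the tangent function\<close>

text \<open>Strict convexity of \<open>tan\<close>: its derivative increases strictly, so the mean
  value theorem puts the graph above its tangent line at \<open>a\<close>.\<close>

lemma tan_tangent_line:
  fixes x a :: real
  assumes "0 \<le> x" "x < pi / 2" "0 < a" "a < pi / 2" "x \<noteq> a"
  shows "tan a + (x - a) / (cos a)\<^sup>2 < tan x"
proof -
  have d: "DERIV tan y :> inverse ((cos y)\<^sup>2)" if "0 \<le> y" "y < pi / 2" for y
    using that by (intro DERIV_tan) (use cos_gt_zero_pi[of y] in auto)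
  have sq: "inverse ((cos y)\<^sup>2) < inverse ((cos z)\<^sup>2)" if "0 \<le> y" "y < z" "z < pi / 2" for y z
    using that cos_monotone_0_pi[of y z] cos_gt_zero[of z]
    by (intro less_imp_inverse_less power_strict_mono) auto
  show ?thesis
  proof (cases "x < a")
    case True
    obtain y where y: "x < y" "y < a" "tan a - tan x = (a - x) * inverse ((cos y)\<^sup>2)"
      using MVT2[OF True, of tan "\<lambda>y. inverse ((cos y)\<^sup>2)"] d assms by auto
    have "(a - x) * inverse ((cos y)\<^sup>2) < (a - x) * inverse ((cos a)\<^sup>2)"
      using sq[of y a] y True assms by (intro mult_strict_left_mono) auto
    then show ?thesis using y(3) by (simp add: divide_inverse algebra_simps)
  next
    case False
    then have lt: "a < x" using assms by simp
    obtain y where y: "a < y" "y < x" "tan x - tan a = (x - a) * inverse ((cos y)\<^sup>2)"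
      using MVT2[OF lt, of tan "\<lambda>y. inverse ((cos y)\<^sup>2)"] d assms by auto
    have "(x - a) * inverse ((cos a)\<^sup>2) < (x - a) * inverse ((cos y)\<^sup>2)"
      using sq[of a y] y lt assms by (intro mult_strict_left_mono) auto
    then show ?thesis using y(3) by (simp add: divide_inverse algebra_simps)
  qed
qed

text \<open>Adding up the tangent line bounds at the mean \<open>a\<close> cancels the linear terms,
  and a single \<open>\<theta> i\<close> different from \<open>a\<close> makes the sum
  strict.\<close>

lemma tan_jensen:
  fixes \<theta> :: "'a \<Rightarrow> real"
  assumes I: "finite I" "2 < card I" and \<theta>: "\<And>i. i \<in> I \<Longrightarrow> 0 \<le> \<theta> i \<and> \<theta> i < pi / 2" and s: "sum \<theta> I = pi"
  shows "card I * tan (pi / card I) \<le> (\<Sum>i\<in>I. tan (\<theta> i))"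
    and "card I * tan (pi / card I) = (\<Sum>i\<in>I. tan (\<theta> i)) \<longleftrightarrow> (\<forall>i\<in>I. \<theta> i = pi / card I)"
proof -
  define a where "a = pi / card I"
  have a: "0 < a" "a < pi / 2" using I by (auto simp: a_def field_simps)
  have le: "tan a + (\<theta> i - a) / (cos a)\<^sup>2 \<le> tan (\<theta> i)" if "i \<in> I" for i
    using tan_tangent_line[of "\<theta> i" a] \<theta>[OF that] a by (cases "\<theta> i = a") auto
  have "(\<Sum>i\<in>I. tan a + (\<theta> i - a) / (cos a)\<^sup>2) = card I * tan a + (sum \<theta> I - card I * a) / (cos a)\<^sup>2"
    by (simp add: sum.distrib sum_divide_distrib[symmetric] sum_subtractf)
  then have eq: "(\<Sum>i\<in>I. tan a + (\<theta> i - a) / (cos a)\<^sup>2) = card I * tan a"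
    using I s by (auto simp: a_def)
  show "card I * tan (pi / card I) \<le> (\<Sum>i\<in>I. tan (\<theta> i))"
    using sum_mono[of I "\<lambda>i. tan a + (\<theta> i - a) / (cos a)\<^sup>2" "\<lambda>i. tan (\<theta> i)"] le eq by (simp add: a_def)
  show "card I * tan (pi / card I) = (\<Sum>i\<in>I. tan (\<theta> i)) \<longleftrightarrow> (\<forall>i\<in>I. \<theta> i = pi / card I)"
  proof
    assume "card I * tan (pi / card I) = (\<Sum>i\<in>I. tan (\<theta> i))"
    then have e: "(\<Sum>i\<in>I. tan a + (\<theta> i - a) / (cos a)\<^sup>2) = (\<Sum>i\<in>I. tan (\<theta> i))"
      using eq by (simp add: a_def)
    show "\<forall>i\<in>I. \<theta> i = pi / card I"
    proof (rule ccontr)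
      assume "\<not> ?thesis"
      then obtain i where i: "i \<in> I" "\<theta> i \<noteq> a" by (auto simp: a_def)
      then have "tan a + (\<theta> i - a) / (cos a)\<^sup>2 < tan (\<theta> i)"
        using tan_tangent_line[of "\<theta> i" a] \<theta>[of i] a by auto
      then show False using sum_strict_mono_ex1[OF I(1), of "\<lambda>i. tan a + (\<theta> i - a) / (cos a)\<^sup>2" "\<lambda>i. tan (\<theta> i)"] le e i(1)
        by auto
    qed
  qed simp
qed


section \<open>Plane vectors and complex coordinates\<close>

definition cross2 :: "real^2 \<Rightarrow> real^2 \<Rightarrow> real" where
  "cross2 x y = x$1 * y$2 - x$2 * y$1"

lemma inner_2: "(x::real^2) \<bullet> y = x$1 * y$1 + x$2 * y$2"
  by (simp add: inner_vec_def sum_2)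

lemma vec_eq_2: "(x::real^2) = y \<longleftrightarrow> x$1 = y$1 \<and> x$2 = y$2"
  by (simp add: vec_eq_iff forall_2)

lemma cross2_add: "cross2 x (y + z) = cross2 x y + cross2 x z"
  and cross2_scaleR: "cross2 x (a *\<^sub>R y) = a * cross2 x y"
  and cross2_self: "cross2 x x = 0"
  by (simp_all add: cross2_def algebra_simps)

text \<open>Up to scaling, the two products are the coordinates of \<open>d\<close> along
  \<open>w\<close> and along \<open>w\<close> turned by a right angle.\<close>

lemma inner_cross2_eq_0:
  assumes "d \<bullet> w = 0" "cross2 d w = 0" "w \<noteq> 0"
  shows "d = 0"
proof -
  have e: "d$1 * w$1 + d$2 * w$2 = 0" "d$1 * w$2 - d$2 * w$1 = 0"
    using assms by (simp_all add: inner_2 cross2_def)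
  have p: "w$1 * w$1 + w$2 * w$2 \<noteq> 0"
    using assms(3) by (simp add: vec_eq_2 sum_squares_eq_zero_iff)
  have "d$1 * (w$1 * w$1 + w$2 * w$2) = 0" "d$2 * (w$1 * w$1 + w$2 * w$2) = 0"
    using e by algebra+
  then show ?thesis using p by (auto simp: vec_eq_2)
qed

lemma inner_eq_0_basis:
  assumes "e \<bullet> x = 0" "e \<bullet> y = 0" "cross2 y x \<noteq> 0"
  shows "e = 0"
proof -
  have "e$1 * cross2 y x = 0" "e$2 * cross2 y x = 0"
    using assms(1,2) unfolding inner_2 cross2_def by algebra+
  then show ?thesis using assms(3) by (simp add: vec_eq_2)
qed

lemma inner_cross2_norm: "(x \<bullet> y)\<^sup>2 + (cross2 x y)\<^sup>2 = (norm x)\<^sup>2 * (norm y)\<^sup>2"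
  unfolding power2_norm_eq_inner inner_2 cross2_def by algebra

text \<open>Taking \<open>\<sigma> = - 1\<close> lets a negatively oriented polygon be reflected into a positively oriented one.\<close>
definition to_complex :: "real \<Rightarrow> real^2 \<Rightarrow> complex" where
  "to_complex \<sigma> x = Complex (x$1) (\<sigma> * x$2)"

lemma to_complex_add: "to_complex \<sigma> (x + y) = to_complex \<sigma> x + to_complex \<sigma> y"
  and to_complex_diff: "to_complex \<sigma> (x - y) = to_complex \<sigma> x - to_complex \<sigma> y"
  and to_complex_scaleR: "to_complex \<sigma> (a *\<^sub>R x) = of_real a * to_complex \<sigma> x"
  by (simp_all add: to_complex_def complex_eq_iff algebra_simps)

lemma
  assumes "\<sigma> * \<sigma> = 1"
  shows to_complex_cnj_mult: "cnj (to_complex \<sigma> x) * to_complex \<sigma> y = Complex (x \<bullet> y) (\<sigma> * cross2 x y)"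
    and norm_to_complex: "norm (to_complex \<sigma> x) = norm x"
    and to_complex_inject: "to_complex \<sigma> x = to_complex \<sigma> y \<longleftrightarrow> x = y"
    and Re_to_complex: "Re (to_complex \<sigma> x * cnj (to_complex \<sigma> y)) = x \<bullet> y"
proof -
  have s: "\<sigma> * (\<sigma> * a) = a" "\<sigma> * a * (\<sigma> * b) = a * b" for a b
    using assms by (metis mult.assoc mult_1, algebra)
  have n0: "\<sigma> \<noteq> 0" using assms by auto
  show "cnj (to_complex \<sigma> x) * to_complex \<sigma> y = Complex (x \<bullet> y) (\<sigma> * cross2 x y)"
    by (simp add: to_complex_def complex_eq_iff inner_2 cross2_def algebra_simps s)
  show "norm (to_complex \<sigma> x) = norm x"
    by (simp add: to_complex_def cmod_def norm_eq_sqrt_inner inner_2 power2_eq_square s)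
  show "to_complex \<sigma> x = to_complex \<sigma> y \<longleftrightarrow> x = y"
    by (auto simp: to_complex_def vec_eq_2 n0)
  show "Re (to_complex \<sigma> x * cnj (to_complex \<sigma> y)) = x \<bullet> y"
    by (simp add: to_complex_def inner_2 s)
qed

text \<open>Reflecting \<open>p\<close> in the foot of the perpendicular from \<open>c\<close> gives
  a point \<open>q\<close> of the same line and circle. Uniqueness forces \<open>q = p\<close>, so
  \<open>p\<close> is the foot.\<close>

lemma tangent_line_orthogonal:
  fixes c p a b :: "'a::real_inner"
  assumes "affine hull {a, b} \<inter> sphere c R = {p}"
  shows "(p - c) \<bullet> (b - a) = 0"
proof (cases "b = a")
  case False
  define d t where "d = b - a" and "t = 2 * ((p - c) \<bullet> d) / (d \<bullet> d)"
  have d: "d \<bullet> d \<noteq> 0" using False by (simp add: d_def)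
  have p: "p \<in> affine hull {a, b}" "dist c p = R" using assms by auto
  define q where "q = p + (- t) *\<^sub>R (b - a)"
  have "q \<in> affine hull {a, b}"
    unfolding q_def using p(1) by (intro mem_affine_3_minus) (auto simp: hull_inc)
  moreover have "(q - c) \<bullet> (q - c) = (p - c) \<bullet> (p - c)"
  proof -
    have "q - c = (p - c) - t *\<^sub>R d" by (simp add: q_def d_def algebra_simps)
    moreover have "(e - t *\<^sub>R d) \<bullet> (e - t *\<^sub>R d) = e \<bullet> e - t * (2 * (e \<bullet> d) - t * (d \<bullet> d))" for e
      by (simp add: inner_diff_left inner_diff_right inner_commute algebra_simps)
    ultimately have "(q - c) \<bullet> (q - c) = (p - c) \<bullet> (p - c) - t * (2 * ((p - c) \<bullet> d) - t * (d \<bullet> d))"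
      by metis
    then show ?thesis using d by (simp add: t_def)
  qed
  then have "dist q c = dist p c" by (simp add: dist_norm norm_eq_sqrt_inner)
  ultimately have "q \<in> affine hull {a, b} \<inter> sphere c R" using p(2) by (simp add: dist_commute)
  then have "q = p" using assms by simp
  then have "t *\<^sub>R d = 0" by (simp add: q_def d_def)
  then show ?thesis using d by (auto simp: t_def d_def)
qed simp

section \<open>Sides, tangent points and supporting lines\<close>

locale tangential_polygon =
  fixes P :: "(real^2) list" and c :: "real^2" and R :: real
  assumes R: "0 < R" and convex_polygon: "convex_polygon P"
    and circumscribed: "circumscribed_about P c R"
begin

abbreviation "n \<equiv> length P"
abbreviation "v \<equiv> vertex P"
abbreviation "S \<equiv> convex hull (set P)"

lemma n: "3 \<le> n" "0 < n" and distinct: "distinct P"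
  using convex_polygon by (auto simp: convex_polygon_def)

lemma vertex_mod: "v (i mod n) = v i" "v (Suc (i mod n)) = v (Suc i)"
  by (simp_all add: vertex_def mod_Suc_eq)

lemma side_mod: "side P (i mod n) = side P i"
  by (simp add: side_def vertex_mod)

lemma vertex_eq_iff: "v i = v j \<longleftrightarrow> i mod n = j mod n"
  using distinct n by (simp add: vertex_def nth_eq_iff_index_eq)

lemma vertex_in: "v i \<in> S"
  using n by (intro hull_inc) (simp add: vertex_def)

lemma Suc_mod_neq: "Suc i mod n \<noteq> i mod n" "Suc (Suc i) mod n \<noteq> i mod n"
  using n by (simp_all add: mod_Suc)

lemma vertex_neq: "v i \<noteq> v (Suc i)"
  using Suc_mod_neq(1)[of i] by (auto simp: vertex_eq_iff)

lemma vertex_in_side: "v i \<in> side P i" "v (Suc i) \<in> side P i"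
  by (simp_all add: side_def)

lemma side_edge: "side P i edge_of S"
  using convex_polygon n side_mod[of i] by (metis convex_polygon_def mod_less_divisor)

lemma side_face: "side P i face_of S"
  using side_edge by (simp add: edge_of_def)

lemma vertex_extreme: "v i extreme_point_of S"
  using extreme_point_of_face[OF side_face, of "v i" i]
  by (simp add: side_def extreme_point_of_segment)

lemma vertex_in_sideD:
  assumes "v j \<in> side P i"
  shows "j mod n = i mod n \<or> j mod n = Suc i mod n"
proof -
  have "v j extreme_point_of side P i"
    using extreme_point_of_face[OF side_face] vertex_extreme assms by blast
  then show ?thesis by (simp add: side_def extreme_point_of_segment vertex_eq_iff)
qed

text \<open>Keeps different sides on different lines: a neighbouring side shares only one end with
  side \<open>i\<close>, because two steps do not lead back to the start when there are at least
  three vertices.\<close>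

lemma side_in_sideD:
  assumes "v j \<in> side P i" "v (Suc j) \<in> side P i"
  shows "j mod n = i mod n"
proof (rule ccontr)
  assume ne: "j mod n \<noteq> i mod n"
  then have j: "j mod n = Suc i mod n" using vertex_in_sideD[OF assms(1)] by simp
  then have "Suc j mod n = Suc (Suc i) mod n" by (metis mod_Suc_eq)
  moreover have "Suc j mod n = i mod n \<or> Suc j mod n = Suc i mod n"
    using vertex_in_sideD[OF assms(2)] .
  ultimately show False using Suc_mod_neq by metis
qed

text \<open>The choice depends on \<open>i\<close> only through \<open>side P i\<close>, which makes
  \<open>p\<close> periodic.\<close>

definition p :: "nat \<Rightarrow> real^2" where
  "p i = (SOME q. q \<in> side P i \<and> affine hull (side P i) \<inter> sphere c R = {q})"

lemma p: "p i \<in> side P i" "affine hull (side P i) \<inter> sphere c R = {p i}"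
proof -
  have "\<exists>q. q \<in> side P (i mod n) \<and> affine hull (side P (i mod n)) \<inter> sphere c R = {q}"
    using circumscribed mod_less_divisor[OF n(2), of i] unfolding circumscribed_about_def by blast
  then have "\<exists>q. q \<in> side P i \<and> affine hull (side P i) \<inter> sphere c R = {q}"
    by (simp only: side_mod)
  from someI_ex[OF this]
  show "p i \<in> side P i" "affine hull (side P i) \<inter> sphere c R = {p i}"
    unfolding p_def by auto
qed

lemma p_mod: "p (i mod n) = p i"
  by (simp add: p_def side_mod)

lemma p_in: "p i \<in> S"
  using p(1) side_face face_of_imp_subset by blast

definition u :: "nat \<Rightarrow> real^2" where "u i = (1 / R) *\<^sub>R (p i - c)"
definition w :: "nat \<Rightarrow> real^2" where "w i = v i - c"

lemma u_mod: "u (i mod n) = u i" and w_mod: "w (i mod n) = w i"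
  by (simp_all add: u_def w_def p_mod vertex_mod)

lemma p_eq: "p i - c = R *\<^sub>R u i"
  using R by (simp add: u_def)

lemma norm_u: "norm (u i) = 1"
proof -
  have "p i \<in> sphere c R" using p(2) by blast
  then show ?thesis using R by (simp add: u_def dist_norm norm_minus_commute)
qed

lemma u_inner_u: "u i \<bullet> u i = 1"
  using norm_u by (simp add: norm_eq_1)

text \<open>The radius to the tangent point is normal to the side, so the functional is constant
  along the side; its value is read off at \<open>p i\<close>.\<close>

lemma u_side: "q \<in> side P i \<Longrightarrow> u i \<bullet> (q - c) = R"
proof -
  have aff: "affine hull (side P i) = affine hull {v i, v (Suc i)}"
    by (simp add: side_def segment_convex_hull affine_hull_convex_hull)
  have "(p i - c) \<bullet> (v (Suc i) - v i) = 0"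
    using tangent_line_orthogonal p(2)[of i] unfolding aff .
  then have orth: "u i \<bullet> (v (Suc i) - v i) = 0" by (simp add: u_def)
  have *: "\<exists>t. q = v i + t *\<^sub>R (v (Suc i) - v i)" if "q \<in> side P i" for q
    using that by (auto simp: side_def closed_segment_def algebra_simps)
  have "u i \<bullet> q = u i \<bullet> v i" if "q \<in> side P i" for q
    using *[OF that] orth by (auto simp: inner_add_right)
  then have "u i \<bullet> (q - c) = u i \<bullet> (p i - c)" if "q \<in> side P i" for q
    using that p(1)[of i] by (simp add: inner_diff_right)
  then show "q \<in> side P i \<Longrightarrow> u i \<bullet> (q - c) = R" by (simp add: p_eq u_inner_u)
qed

lemma u_w: "u i \<bullet> w i = R" "u i \<bullet> w (Suc i) = R"
  using u_side vertex_in_side by (simp_all add: w_def)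

lemma side_neq: "\<not> set P \<subseteq> side P i"
proof
  assume "set P \<subseteq> side P i"
  moreover have "v j \<in> set P" for j using n by (simp add: vertex_def)
  ultimately have "Suc i mod n = i mod n" by (intro side_in_sideD) auto
  then show False using Suc_mod_neq by metis
qed

text \<open>A face of a polytope is exposed, which supplies a supporting line with some normal
  \<open>a\<close>. Both \<open>a\<close> and \<open>u i\<close> are orthogonal to the side, so in
  the plane \<open>a = k *\<^sub>R u i\<close>. The sign of \<open>k\<close>, that is, on which side
  of the line the polygon lies, is still open here.\<close>

lemma supporting:
  obtains k where "k \<noteq> 0" "\<And>x. x \<in> S \<Longrightarrow> k * (u i \<bullet> (x - c)) \<le> k * R"
    "\<And>x. x \<in> S \<Longrightarrow> u i \<bullet> (x - c) = R \<Longrightarrow> x \<in> side P i"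
proof -
  have "polyhedron S" by (simp add: polyhedron_convex_hull)
  then have "side P i exposed_face_of S"
    using side_face exposed_face_of_polyhedron by blast
  then obtain a b where ab: "S \<subseteq> {x. a \<bullet> x \<le> b}" "side P i = S \<inter> {x. a \<bullet> x = b}"
    by (auto simp: exposed_face_of_def)
  define d where "d = v (Suc i) - v i"
  have "a \<bullet> v i = b" "a \<bullet> v (Suc i) = b" using vertex_in_side[of i] ab(2) by auto
  then have ad: "a \<bullet> d = 0" by (simp add: d_def inner_diff_right)
  have ud: "u i \<bullet> d = 0" using u_w[of i] by (simp add: d_def w_def inner_diff_right)
  have d0: "d \<noteq> 0" using vertex_neq[of i] by (simp add: d_def)
  define k where "k = a \<bullet> u i"
  have "(a - k *\<^sub>R u i) \<bullet> d = 0" using ad ud by (simp add: inner_diff_left)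
  moreover have "(a - k *\<^sub>R u i) \<bullet> u i = 0" by (simp add: k_def inner_diff_left u_inner_u)
  moreover have "cross2 (u i) d \<noteq> 0"
    using inner_cross2_eq_0[OF ud _ d0] norm_u[of i] by auto
  ultimately have "a - k *\<^sub>R u i = 0" by (intro inner_eq_0_basis)
  then have a: "a = k *\<^sub>R u i" by simp
  have b: "b = k * (u i \<bullet> v i)" using \<open>a \<bullet> v i = b\<close> by (simp add: a)
  have k0: "k \<noteq> 0"
  proof
    assume "k = 0"
    then have "S = side P i" using ab(2) b a by simp
    then show False using side_neq[of i] hull_subset[of "set P" convex] by simp
  qed
  have uv: "u i \<bullet> v i = R + u i \<bullet> c" using u_w(1)[of i] by (simp add: w_def inner_diff_right)
  show thesis
  proof (rule that[OF k0])
    fix x assume x: "x \<in> S"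
    then show "k * (u i \<bullet> (x - c)) \<le> k * R"
      using ab(1) unfolding a b uv by (auto simp: inner_diff_right algebra_simps)
    assume "u i \<bullet> (x - c) = R"
    then have "a \<bullet> x = b" unfolding a b uv by (simp add: inner_diff_right)
    then show "x \<in> side P i" using ab(2) x by simp
  qed
qed

lemma on_line_side: "x \<in> S \<Longrightarrow> u i \<bullet> (x - c) = R \<Longrightarrow> x \<in> side P i"
  using supporting by metis

text \<open>Equal normals put side \<open>j\<close> on the supporting line of side \<open>i\<close>,
  which meets the hull in side \<open>i\<close> only.\<close>

lemma u_eq_iff: "u i = u j \<longleftrightarrow> i mod n = j mod n"
proof
  assume "u i = u j"
  then have "v j \<in> side P i" "v (Suc j) \<in> side P i"
    using u_w[of j] vertex_in by (auto intro!: on_line_side simp: w_def)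
  then show "i mod n = j mod n" using side_in_sideD by simp
qed (metis u_mod)

text \<open>The polygon and the circle lie on the same side of every side line: otherwise every tangent
  point, being in the polygon, would have to equal that of side \<open>i\<close>.\<close>
lemma halfplane: "x \<in> S \<Longrightarrow> u i \<bullet> (x - c) \<le> R"
proof -
  obtain k where k: "k \<noteq> 0" "\<And>x. x \<in> S \<Longrightarrow> k * (u i \<bullet> (x - c)) \<le> k * R"
    using supporting by metis
  have "0 < k"
  proof (rule ccontr)
    assume "\<not> 0 < k"
    then have "k < 0" using k(1) by simp
    then have "R \<le> u i \<bullet> (p (Suc i) - c)" using k(2)[OF p_in[of "Suc i"]] by simp
    then have "1 \<le> u i \<bullet> u (Suc i)" using R by (simp add: p_eq)
    then have "(u i - u (Suc i)) \<bullet> (u i - u (Suc i)) \<le> 0"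
      by (simp add: inner_diff_left inner_diff_right u_inner_u inner_commute)
    then have "u i = u (Suc i)" by (meson inner_gt_zero_iff not_less eq_iff_diff_eq_0)
    then show False using u_eq_iff[of i "Suc i"] Suc_mod_neq(1)[of i] by simp
  qed
  then show "x \<in> S \<Longrightarrow> u i \<bullet> (x - c) \<le> R" using k(2) by simp
qed

text \<open>Strictness is what later supplies the assumption \<open>convex\<close> of
  \<open>tangent_chain\<close>.\<close>

lemma u_w_less:
  assumes "j mod n \<noteq> i mod n" "j mod n \<noteq> Suc i mod n"
  shows "u i \<bullet> w j < R"
proof -
  have "u i \<bullet> w j \<noteq> R"
    using assms vertex_in_sideD on_line_side[OF vertex_in, of i j] by (auto simp: w_def)
  then show ?thesis using halfplane[OF vertex_in, of i j] by (simp add: w_def)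
qed

text \<open>\<open>\<tau> i\<close> is the length of the two tangent segments from vertex \<open>i\<close>, and \<open>\<sigma>\<close> is the orientation.\<close>
definition \<tau> :: "nat \<Rightarrow> real" where "\<tau> i = sqrt ((norm (w i))\<^sup>2 - R\<^sup>2)"
definition \<theta> :: "nat \<Rightarrow> real" where "\<theta> i = arctan (\<tau> i / R)"
definition \<sigma> :: real where "\<sigma> = sgn (cross2 (u 0) (w 1))"

section \<open>Equal tangent lengths and a common orientation\<close>

lemma cross2_sq: "(cross2 (u i) (w i))\<^sup>2 = (norm (w i))\<^sup>2 - R\<^sup>2"
  "(cross2 (u i) (w (Suc i)))\<^sup>2 = (norm (w (Suc i)))\<^sup>2 - R\<^sup>2"
  using inner_cross2_norm[of "u i" "w i"] inner_cross2_norm[of "u i" "w (Suc i)"]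
  by (simp_all add: u_w norm_u)

lemma w_neq_0: "w i \<noteq> 0"
  using u_w(1)[of i] R by auto

text \<open>The two tangents from a vertex have the same length, so the cross products agree up to
  sign. With equal signs the two normals would coincide, having also the same inner product with
  \<open>w (Suc i)\<close>.\<close>

lemma cross2_Suc: "cross2 (u (Suc i)) (w (Suc i)) = - cross2 (u i) (w (Suc i))"
  and cross2_neq_0: "cross2 (u i) (w (Suc i)) \<noteq> 0"
proof -
  have ne: "cross2 (u (Suc i)) (w (Suc i)) \<noteq> cross2 (u i) (w (Suc i))"
  proof
    assume "cross2 (u (Suc i)) (w (Suc i)) = cross2 (u i) (w (Suc i))"
    then have "cross2 (u (Suc i) - u i) (w (Suc i)) = 0" by (simp add: cross2_def algebra_simps)
    moreover have "(u (Suc i) - u i) \<bullet> w (Suc i) = 0" by (simp add: inner_diff_left u_w)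
    ultimately have "u (Suc i) = u i" using inner_cross2_eq_0 w_neq_0 by fastforce
    then show False using u_eq_iff Suc_mod_neq by metis
  qed
  have "(cross2 (u (Suc i)) (w (Suc i)))\<^sup>2 = (cross2 (u i) (w (Suc i)))\<^sup>2"
    by (simp add: cross2_sq)
  with ne show "cross2 (u (Suc i)) (w (Suc i)) = - cross2 (u i) (w (Suc i))"
    by (simp add: power2_eq_iff)
  with ne show "cross2 (u i) (w (Suc i)) \<noteq> 0" by auto
qed

text \<open>The tangent point lies between the ends of its side, so the ends are on opposite sides
  of the ray to it; \<open>cross2_Suc\<close> then passes the sign on from one side to the
  next.\<close>

lemma cross2_sgn_Suc: "sgn (cross2 (u (Suc i)) (w (Suc (Suc i)))) = sgn (cross2 (u i) (w (Suc i)))"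
proof -
  obtain s where s: "0 \<le> s" "s \<le> 1" "p (Suc i) = (1 - s) *\<^sub>R v (Suc i) + s *\<^sub>R v (Suc (Suc i))"
    using p(1)[of "Suc i"] by (auto simp: side_def closed_segment_def)
  then have "R *\<^sub>R u (Suc i) = (1 - s) *\<^sub>R w (Suc i) + s *\<^sub>R w (Suc (Suc i))"
    by (simp add: p_eq[symmetric] w_def algebra_simps)
  then have "cross2 (u (Suc i)) (R *\<^sub>R u (Suc i)) = (1 - s) * cross2 (u (Suc i)) (w (Suc i))
      + s * cross2 (u (Suc i)) (w (Suc (Suc i)))"
    by (simp add: cross2_add cross2_scaleR)
  then have "(1 - s) * cross2 (u i) (w (Suc i)) = s * cross2 (u (Suc i)) (w (Suc (Suc i)))"
    by (simp add: cross2_scaleR cross2_self cross2_Suc)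
  then have "sgn (1 - s) * sgn (cross2 (u i) (w (Suc i))) = sgn s * sgn (cross2 (u (Suc i)) (w (Suc (Suc i))))"
    by (metis sgn_mult)
  then show ?thesis using s cross2_neq_0[of i] cross2_neq_0[of "Suc i"]
    by (cases "s = 0"; cases "s = 1") (auto simp: sgn_zero_iff)
qed

lemma cross2_sgn: "sgn (cross2 (u i) (w (Suc i))) = \<sigma>"
  by (induction i) (simp_all add: \<sigma>_def cross2_sgn_Suc)

lemma \<sigma>: "\<sigma> * \<sigma> = 1"
  using cross2_neq_0[of 0] by (simp add: \<sigma>_def flip: sgn_mult) 

lemma \<sigma>_cross2: "\<sigma> * cross2 (u i) (w (Suc i)) = \<tau> (Suc i)" "\<sigma> * cross2 (u i) (w i) = - \<tau> i"
proof -
  have *: "\<sigma> * cross2 (u i) (w (Suc i)) = \<tau> (Suc i)" for i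
    by (simp add: \<tau>_def cross2_sq(2)[of i, symmetric] cross2_sgn[of i, symmetric] sgn_mult_self_eq abs_sgn mult.commute)
  show "\<sigma> * cross2 (u i) (w (Suc i)) = \<tau> (Suc i)" by (rule *)
  \<comment> \<open>A period is added so that index 0 becomes a successor too.\<close>
  obtain k where k: "i + n = Suc k" using n by (cases "i + n") auto
  have "u i = u (Suc k)" "w i = w (Suc k)"
    by (metis k mod_add_self2 u_mod, metis k mod_add_self2 w_mod)
  then show "\<sigma> * cross2 (u i) (w i) = - \<tau> i" using *[of k] by (simp add: cross2_Suc \<tau>_def)
qed

lemma \<tau>_pos: "0 < \<tau> i"
proof -
  have "cross2 (u i) (w i) \<noteq> 0"
    by (metis cross2_Suc cross2_neq_0 mod_add_self2 neg_equal_0_iff_equal not0_implies_Suc add_is_0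
        n(2) less_irrefl u_mod w_mod)
  then show ?thesis by (simp add: \<tau>_def cross2_sq(1)[of i, symmetric])
qed

lemma \<theta>: "0 < \<theta> i" "\<theta> i < pi / 2"
  using \<tau>_pos[of i] R arctan_ubound by (auto simp: \<theta>_def)

lemma tan_\<theta>: "R * tan (\<theta> i) = \<tau> i"
  using R by (simp add: \<theta>_def tan_arctan)

lemma cos_\<theta>: "0 < cos (\<theta> i)"
  using \<theta>[of i] by (intro cos_gt_zero) auto

section \<open>The polygon in complex coordinates\<close>

abbreviation f :: "real^2 \<Rightarrow> complex" where "f \<equiv> to_complex \<sigma>"

lemma f_u_cnj: "f (u i) * cnj (f (u i)) = 1"
  by (metis complex_norm_square norm_to_complex[OF \<sigma>] norm_u of_real_1 one_power2)

text \<open>Multiplying by \<open>cnj (f (u i))\<close>, the inverse of \<open>f (u i)\<close>,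
  gives the radial and the tangential coordinate of a vertex seen from side
  \<open>i\<close>.\<close>

lemma f_w: "f (w (Suc i)) = f (u i) * Complex R (\<tau> (Suc i))" "f (w i) = f (u i) * Complex R (- \<tau> i)"
proof -
  have *: "f x = f (u i) * (cnj (f (u i)) * f x)" for x
    by (simp add: f_u_cnj flip: mult.assoc)
  show "f (w (Suc i)) = f (u i) * Complex R (\<tau> (Suc i))" 
    by (subst *) (simp add: to_complex_cnj_mult[OF \<sigma>] u_w \<sigma>_cross2)
  show "f (w i) = f (u i) * Complex R (- \<tau> i)"
    by (subst *) (simp add: to_complex_cnj_mult[OF \<sigma>] u_w \<sigma>_cross2)
qed

lemma Complex_cis: "Complex R (\<tau> i) = of_real (R / cos (\<theta> i)) * cis (\<theta> i)"
  "Complex R (- \<tau> i) = of_real (R / cos (\<theta> i)) * cis (- \<theta> i)"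
  using cos_\<theta>[of i] tan_\<theta>[of i] by (simp_all add: complex_eq_iff tan_def)

lemma f_w_cis: "f (w (Suc i)) = of_real (R / cos (\<theta> (Suc i))) * (f (u i) * cis (\<theta> (Suc i)))"
  "f (w i) = of_real (R / cos (\<theta> i)) * (f (u i) * cis (- \<theta> i))"
  using f_w[of i] by (simp_all add: Complex_cis)

sublocale tangent_chain n "\<lambda>i. f (u i)" \<theta>
proof
  show "2 < n" using n by simp
  show "norm (f (u 0)) = 1" by (simp add: norm_to_complex[OF \<sigma>] norm_u)
  show "f (u n) = f (u 0)" using u_mod[of n] by simp
  show "0 < \<theta> i" "\<theta> i < pi / 2" for i by (fact \<theta>)+
  show "f (u (Suc i)) = f (u i) * cis (2 * \<theta> (Suc i))" for i
  proof -
    \<comment> \<open>Two polar forms of the same vertex, one from each adjacent side; the common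
      modulus cancels.\<close>
    have "f (u i) * cis (\<theta> (Suc i)) = f (u (Suc i)) * cis (- \<theta> (Suc i))"
      using f_w_cis(1)[of i] f_w_cis(2)[of "Suc i"] R cos_\<theta>[of "Suc i"] by simp
    then have "f (u i) * cis (\<theta> (Suc i)) * cis (\<theta> (Suc i)) = f (u (Suc i))"
      by (simp add: cis_mult mult.assoc)
    then show ?thesis by (simp add: cis_mult mult.assoc)
  qed
  show "Re (f (u j) * cis (- \<theta> j) * cnj (f (u 0))) < cos (\<theta> j)" if "2 \<le> j" "j < n" for j
  proof -
    have "u 0 \<bullet> w j < R" using that n by (intro u_w_less) auto
    moreover have "u 0 \<bullet> w j = R / cos (\<theta> j) * Re (f (u j) * cis (- \<theta> j) * cnj (f (u 0)))"
      using Re_to_complex[OF \<sigma>, of "w j" "u 0"] unfolding f_w_cis(2)[of j]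
      by (simp add: inner_commute mult.assoc del: of_real_divide)
    moreover have "y < cos (\<theta> j)" if "R / cos (\<theta> j) * y < R" for y
      using that R cos_\<theta>[of j] by (simp add: field_simps)
    ultimately show ?thesis by metis
  qed
qed

section \<open>Side lengths, perimeter and angles\<close>

lemma sum_\<theta>: "(\<Sum>i<n. \<theta> (Suc i)) = pi"
  using total_turning by (simp add: \<phi>_def)

lemma f_side: "f (v (Suc i) - v i) = f (u i) * (\<i> * of_real (\<tau> i + \<tau> (Suc i)))"
proof -
  have "v (Suc i) - v i = w (Suc i) - w i" by (simp add: w_def)
  then have "f (v (Suc i) - v i) = f (u i) * (Complex R (\<tau> (Suc i)) - Complex R (- \<tau> i))"
    by (simp only: to_complex_diff f_w(1)[of i] f_w(2)[of i] right_diff_distrib)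
  also have "Complex R (\<tau> (Suc i)) - Complex R (- \<tau> i) = \<i> * of_real (\<tau> i + \<tau> (Suc i))"
    by (simp add: complex_eq_iff)
  finally show ?thesis .
qed

lemma side_length: "dist (v i) (v (Suc i)) = \<tau> i + \<tau> (Suc i)"
proof -
  have "norm (v (Suc i) - v i) = \<tau> i + \<tau> (Suc i)"
    unfolding norm_to_complex[OF \<sigma>, symmetric] f_side
    using \<tau>_pos[of i] \<tau>_pos[of "Suc i"]
    by (simp add: norm_mult norm_to_complex[OF \<sigma>] norm_u del: of_real_add)
  then show ?thesis by (simp add: dist_norm norm_minus_commute)
qed

lemma \<tau>_n: "\<tau> n = \<tau> 0"
  using w_mod[of n] by (simp add: \<tau>_def)

lemma perimeter_eq: "perimeter P = 2 * R * (\<Sum>i<n. tan (\<theta> (Suc i)))"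
proof -
  \<comment> \<open>Each vertex contributes its tangent length to both of its sides, so a cyclic
    shift merges the two sums.\<close>
  have "(\<Sum>i<n. \<tau> i) = (\<Sum>i<n. \<tau> (Suc i))"
    using sum.lessThan_Suc[of \<tau> n] sum.lessThan_Suc_shift[of \<tau> n] \<tau>_n by simp
  then have "perimeter P = 2 * (\<Sum>i<n. \<tau> (Suc i))"
    by (simp add: perimeter_def side_length sum.distrib)
  also have "(\<Sum>i<n. \<tau> (Suc i)) = R * (\<Sum>i<n. tan (\<theta> (Suc i)))"
    by (simp add: sum_distrib_left tan_\<theta>)
  finally show ?thesis by simp
qed

text \<open>Side vectors are the normals turned by a right angle, so the direction changes by
  \<open>2 * \<theta> (Suc i)\<close> at the vertex, and the interior angle is the
  supplement.\<close>

lemma interior_angle_eq: "interior_angle P i = pi - 2 * \<theta> (Suc i)"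
proof -
  define x y where "x = \<tau> i + \<tau> (Suc i)" and "y = \<tau> (Suc i) + \<tau> (Suc (Suc i))"
  define a b where "a = v i - v (Suc i)" and "b = v (Suc (Suc i)) - v (Suc i)"
  have xy: "0 < x" "0 < y" using \<tau>_pos by (simp_all add: x_def y_def add_pos_pos)
  have "norm a = x" "norm b = y"
    using side_length[of i] side_length[of "Suc i"]
    by (simp_all add: a_def b_def x_def y_def dist_norm norm_minus_commute)
  moreover have "a \<bullet> b = - (x * y * cos (2 * \<theta> (Suc i)))"
  proof -
    have "b \<bullet> (- a) = Re (f b * cnj (f (- a)))" by (simp only: Re_to_complex[OF \<sigma>])
    also have "f (- a) = f (u i) * (\<i> * of_real x)" using f_side[of i] by (simp add: a_def x_def)
    also have "f b = f (u i) * cis (2 * \<theta> (Suc i)) * (\<i> * of_real y)"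
      using f_side[of "Suc i"] u_Suc[of i] by (simp add: b_def y_def)
    also have "f (u i) * cis (2 * \<theta> (Suc i)) * (\<i> * of_real y) * cnj (f (u i) * (\<i> * of_real x))
        = (f (u i) * cnj (f (u i))) * (of_real (x * y) * cis (2 * \<theta> (Suc i)))"
      by (simp add: algebra_simps)
    also have "f (u i) * cnj (f (u i)) = 1"
      by (rule f_u_cnj)
    finally have "b \<bullet> (- a) = x * y * cos (2 * \<theta> (Suc i))" by simp
    then show ?thesis by (simp add: inner_commute)
  qed
  ultimately have "interior_angle P i = arccos (- cos (2 * \<theta> (Suc i)))"
    using xy by (simp add: interior_angle_def Let_def a_def b_def)
  also have "\<dots> = pi - 2 * \<theta> (Suc i)"
    using \<theta>[of "Suc i"] by (simp add: arccos_minus arccos_cos)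
  finally show ?thesis .
qed

text \<open>Equal interior angles mean equal \<open>\<theta>\<close>, whose sum pi fixes the value;
  conversely, equal \<open>\<theta>\<close> give equal tangent lengths and thereby equal
  sides.\<close>

lemma regular_iff: "regular_polygon P \<longleftrightarrow> (\<forall>i<n. \<theta> (Suc i) = pi / n)"
proof
  assume "regular_polygon P"
  then have eq: "\<theta> (Suc i) = \<theta> (Suc 0)" if "i < n" for i
  proof -
    have "interior_angle P i = interior_angle P 0"
      using \<open>regular_polygon P\<close> that n(2) unfolding regular_polygon_def by blast
    then show ?thesis by (simp add: interior_angle_eq)
  qed
  have "pi = n * \<theta> (Suc 0)"
    using eq sum_\<theta> sum.cong[of "{..<n}" "{..<n}" "\<lambda>i. \<theta> (Suc i)" "\<lambda>i. \<theta> (Suc 0)"] by simp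
  then have "\<theta> (Suc 0) = pi / n" using n by (simp add: field_simps)
  then show "\<forall>i<n. \<theta> (Suc i) = pi / n" using eq by simp
next
  assume e: "\<forall>i<n. \<theta> (Suc i) = pi / n"
  define t where "t = R * tan (pi / n)"
  have t: "\<tau> (Suc i) = t" if "i < n" for i
    by (simp only: t_def tan_\<theta>[symmetric] e[rule_format, OF that])
  have "\<tau> 0 = t" using t[of "n - 1"] \<tau>_n n(2) by simp
  then have "\<tau> i = t" if "i < n" for i
    using that t by (cases i) auto
  then show "regular_polygon P"
    using convex_polygon e t by (simp add: regular_polygon_def interior_angle_eq side_length)
qed

lemma perimeter_ge: "perimeter P \<ge> 2 * R * (n * tan (pi / n))"
  and perimeter_eq_iff: "perimeter P = 2 * R * (n * tan (pi / n)) \<longleftrightarrow> regular_polygon P"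
proof -
  have *: "0 \<le> \<theta> (Suc i) \<and> \<theta> (Suc i) < pi / 2" for i
    using \<theta>[of "Suc i"] by (simp add: less_imp_le)
  note jensen = tan_jensen[of "{..<n}" "\<lambda>i. \<theta> (Suc i)", OF _ _ * sum_\<theta>]
  show "perimeter P \<ge> 2 * R * (n * tan (pi / n))"
    using jensen(1) n(1) R unfolding perimeter_eq by simp
  have "perimeter P = 2 * R * (n * tan (pi / n)) \<longleftrightarrow> n * tan (pi / n) = (\<Sum>i<n. tan (\<theta> (Suc i)))"
    using R unfolding perimeter_eq by auto
  then show "perimeter P = 2 * R * (n * tan (pi / n)) \<longleftrightarrow> regular_polygon P"
    using jensen(2) n(1) by (simp add: regular_iff Ball_def)
qed

section \<open>Dissection into triangles and the area\<close>

text \<open>By \<open>cover\<close>, \<open>x - c\<close> is in the cone spanned by a tangent point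
  and a vertex of one and the same side; dividing by the sum of the coefficients gives a point of
  that side.\<close>

lemma ray_meets_side:
  obtains i s q where "i < n" "0 \<le> s" "q \<in> side P i" "x = c + s *\<^sub>R (q - c)"
proof -
  obtain j i a b where ab: "j < n" "i = j \<or> i = Suc j" "0 \<le> a" "0 \<le> b"
    "f (x - c) = of_real a * f (u i) + of_real b * (f (u j) * cis (\<theta> (Suc j)))"
    using cover by blast
  \<comment> \<open>The tangent point is at distance \<open>R\<close> from the centre and the vertex
    at distance \<open>R / cos (\<theta> (Suc j))\<close>, whereas \<open>cover\<close> uses unit
    directions.\<close>
  define \<alpha> \<beta> where "\<alpha> = a / R" and "\<beta> = b * cos (\<theta> (Suc j)) / R"
  have nn: "0 \<le> \<alpha>" "0 \<le> \<beta>" using ab R cos_\<theta>[of "Suc j"] by (simp_all add: \<alpha>_def \<beta>_def)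
  have "of_real b * (f (u j) * cis (\<theta> (Suc j))) = of_real \<beta> * f (w (Suc j))"
    unfolding f_w_cis(1)[of j] using cos_\<theta>[of "Suc j"] R by (simp add: \<beta>_def)
  moreover have "of_real a * f (u i) = of_real \<alpha> * f (p i - c)"
    using R by (simp add: p_eq to_complex_scaleR \<alpha>_def)
  ultimately have "f (x - c) = f (\<alpha> *\<^sub>R (p i - c) + \<beta> *\<^sub>R w (Suc j))"
    using ab by (simp add: to_complex_add to_complex_scaleR)
  then have xc: "x - c = \<alpha> *\<^sub>R (p i - c) + \<beta> *\<^sub>R (v (Suc j) - c)"
    by (simp add: to_complex_inject[OF \<sigma>] w_def)
  have vi: "v (Suc j) \<in> side P i" using ab(2) vertex_in_side by auto
  have "\<exists>q \<in> side P i. x - c = (\<alpha> + \<beta>) *\<^sub>R (q - c)"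
  proof (cases "\<alpha> + \<beta> = 0")
    case True
    then have "\<alpha> = 0" "\<beta> = 0" using nn by auto
    then show ?thesis using xc vi by auto
  next
    case False
    then have pos: "0 < \<alpha> + \<beta>" using nn by simp
    define q where "q = (\<alpha> / (\<alpha> + \<beta>)) *\<^sub>R p i + (\<beta> / (\<alpha> + \<beta>)) *\<^sub>R v (Suc j)"
    have "q \<in> side P i"
      unfolding q_def using p(1)[of i] vi pos nn
      by (intro convexD) (auto simp: side_def add_divide_distrib[symmetric])
    moreover have "(\<alpha> + \<beta>) *\<^sub>R (q - c) = x - c"
      unfolding xc q_def using False by (simp add: scaleR_add_right scaleR_diff_right scaleR_add_left)
    ultimately show ?thesis by metis
  qed
  then obtain q where q: "q \<in> side P (i mod n)" "x = c + (\<alpha> + \<beta>) *\<^sub>R (q - c)"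
    by (metis side_mod add.commute diff_add_cancel)
  \<comment> \<open>Reduction modulo \<open>n\<close> is needed since \<open>i\<close> may be
    \<open>n\<close>, namely \<open>Suc j\<close> for the last \<open>j\<close>.\<close>
  show thesis
    by (rule that[of "i mod n" "\<alpha> + \<beta>" q]) (use q n nn in auto)
qed

text \<open>The ray from \<open>c\<close> opposite to \<open>p 0\<close> meets a side in some
  \<open>q\<close>, which puts \<open>c\<close> on the segment from \<open>p 0\<close> to
  \<open>q\<close>.\<close>

lemma centre_in: "c \<in> S"
proof -
  obtain i s q where *: "0 \<le> s" "q \<in> side P i" "c - (p 0 - c) = c + s *\<^sub>R (q - c)"
    using ray_meets_side by metis
  then have "(1 + s) *\<^sub>R c = p 0 + s *\<^sub>R q" by (simp add: algebra_simps)
  then have "c = (1 / (1 + s)) *\<^sub>R (p 0 + s *\<^sub>R q)" using * by (simp add: vector_fraction_eq_iff eq_vector_fraction_iff)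
  then have "c = (1 / (1 + s)) *\<^sub>R p 0 + (s / (1 + s)) *\<^sub>R q" by (simp add: scaleR_add_right)
  moreover have "q \<in> S" using * side_face face_of_imp_subset by blast
  then have "(1 / (1 + s)) *\<^sub>R p 0 + (s / (1 + s)) *\<^sub>R q \<in> S"
    using *(1) p_in[of 0] by (intro convexD) (auto simp: add_divide_distrib[symmetric])
  ultimately show ?thesis by simp
qed

definition T :: "nat \<Rightarrow> (real^2) set" where "T i = convex hull {c, v i, v (Suc i)}"

lemma mem_T: "x \<in> T i \<longleftrightarrow> (\<exists>s q. 0 \<le> s \<and> s \<le> 1 \<and> q \<in> side P i \<and> x = c + s *\<^sub>R (q - c))"
proof -
  have "T i = (\<Union>q\<in>side P i. closed_segment c q)"
    unfolding T_def side_def segment_convex_hull(1)[of "v i"] by (subst convex_hull_insert_segments) simp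
  moreover have "(1 - s) *\<^sub>R c + s *\<^sub>R q = c + s *\<^sub>R (q - c)" for s q
    by (simp add: algebra_simps)
  ultimately show ?thesis by (auto simp: closed_segment_def)
qed

lemma S_eq_Union_T: "S = (\<Union>i<n. T i)"
proof
  show "S \<subseteq> (\<Union>i<n. T i)"
  proof
    fix x assume x: "x \<in> S"
    obtain i s q where *: "i < n" "0 \<le> s" "q \<in> side P i" "x = c + s *\<^sub>R (q - c)"
      using ray_meets_side by metis
    \<comment> \<open>The functional of side \<open>i\<close> has value \<open>R\<close> at
      \<open>q\<close>, hence \<open>s * R\<close> at \<open>x\<close>.\<close>
    have "s * R \<le> R" using halfplane[OF x, of i] u_side[OF *(3)] *(4) by simp
    then have "s \<le> 1" using R by simp
    then show "x \<in> (\<Union>i<n. T i)" using * by (auto simp: mem_T)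
  qed
  show "(\<Union>i<n. T i) \<subseteq> S"
  proof -
    have "T i \<subseteq> S" for i
      unfolding T_def by (rule hull_minimal) (simp_all add: centre_in vertex_in)
    then show ?thesis by blast
  qed
qed

text \<open>On \<open>T i\<close> the functional \<open>\<lambda>x. u i \<bullet> (x - c)\<close> is the largest of its kind, so on \<open>T i \<inter> T j\<close> two of
  them agree.\<close>
lemma T_Int_negligible:
  assumes "i < n" "j < n" "i \<noteq> j"
  shows "negligible (T i \<inter> T j)"
proof (rule negligible_subset)
  have "u i - u j \<noteq> 0" using u_eq_iff[of i j] assms by simp
  then show "negligible {x. (u i - u j) \<bullet> x = (u i - u j) \<bullet> c}"
    by (intro negligible_hyperplane) auto
  show "T i \<inter> T j \<subseteq> {x. (u i - u j) \<bullet> x = (u i - u j) \<bullet> c}"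
  proof
    fix x assume x: "x \<in> T i \<inter> T j"
    have le: "u l \<bullet> (x - c) \<le> u k \<bullet> (x - c)" if xk: "x \<in> T k" for k l
    proof -
      obtain s q where *: "0 \<le> s" "q \<in> side P k" "x = c + s *\<^sub>R (q - c)"
        using xk by (auto simp: mem_T)
      have "q \<in> S" using * side_face face_of_imp_subset by blast
      then have "u l \<bullet> (q - c) \<le> u k \<bullet> (q - c)" using halfplane u_side[OF *(2)] by simp
      then show ?thesis using * by (simp add: mult_left_mono)
    qed
    have "u i \<bullet> (x - c) = u j \<bullet> (x - c)" using le[of i j] le[of j i] x by auto
    then show "x \<in> {x. (u i - u j) \<bullet> x = (u i - u j) \<bullet> c}"
      by (simp add: inner_diff_left inner_diff_right)
  qed
qed

lemma measure_T: "measure lborel (T i) = R * (\<tau> i + \<tau> (Suc i)) / 2"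
proof -
  have "measure lborel (T i) = \<bar>cross2 (w i) (w (Suc i))\<bar> / 2"
    unfolding T_def content_triangle by (simp add: cross2_def w_def algebra_simps)
  moreover have "\<sigma> * cross2 (w i) (w (Suc i)) = R * (\<tau> i + \<tau> (Suc i))"
  proof -
    have "\<sigma> * cross2 (w i) (w (Suc i)) = Im (cnj (f (w i)) * f (w (Suc i)))"
      by (simp only: to_complex_cnj_mult[OF \<sigma>] complex.sel)
    also have "cnj (f (w i)) * f (w (Suc i))
        = (f (u i) * cnj (f (u i))) * (cnj (Complex R (- \<tau> i)) * Complex R (\<tau> (Suc i)))"
      by (simp add: f_w(1)[of i] f_w(2)[of i])
    also have "f (u i) * cnj (f (u i)) = 1"
      by (rule f_u_cnj)
    finally show ?thesis by (simp add: algebra_simps)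
  qed
  moreover have "\<bar>\<sigma>\<bar> = 1" using \<sigma> by (simp flip: abs_square_eq_1 add: power2_eq_square)
  ultimately show ?thesis
    using \<tau>_pos[of i] \<tau>_pos[of "Suc i"] R
    by (metis abs_mult abs_of_pos add_pos_pos mult_1 mult_pos_pos)
qed

lemma area_eq: "area P = R * perimeter P / 2"
proof -
  have lm: "T i \<in> lmeasurable" for i
    unfolding T_def by (intro lmeasurable_compact compact_convex_hull) auto
  \<comment> \<open>Additivity up to negligible overlaps is available for \<open>lebesgue\<close>,
    hence the passage to the completion and back.\<close>
  have "area P = measure lebesgue S"
    unfolding area_def by (intro measure_completion[symmetric]) (simp add: compact_convex_hull compact_imp_closed finite_imp_compact)
  also have "\<dots> = (\<Sum>i<n. measure lebesgue (T i))"
    unfolding S_eq_Union_T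
    by (intro measure_negligible_finite_Union_image) (auto simp: lm pairwise_def T_Int_negligible)
  also have "\<dots> = (\<Sum>i<n. measure lborel (T i))"
    by (intro sum.cong refl measure_completion) (auto simp: T_def compact_convex_hull compact_imp_closed finite_imp_compact)
  also have "\<dots> = R * perimeter P / 2"
    by (simp add: measure_T perimeter_def side_length sum_distrib_left sum_divide_distrib)
  finally show ?thesis .
qed

end

section \<open>The power inequalities\<close>

lemma power_inequality:
  fixes t d e :: real
  assumes "0 \<le> e" "e < d" "d \<le> t" "0 < k"
  shows "t ^ (2 * k) - d ^ k * t ^ k \<ge> e ^ k * (t ^ k - d ^ k)"
    and "t ^ (2 * k) - d ^ k * t ^ k = e ^ k * (t ^ k - d ^ k) \<longleftrightarrow> t = d"
proof -
  have eq: "t ^ (2 * k) - d ^ k * t ^ k - e ^ k * (t ^ k - d ^ k) = (t ^ k - d ^ k) * (t ^ k - e ^ k)"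
    by (simp add: power_mult power2_eq_square power_mult_distrib algebra_simps)
  have 1: "e ^ k < t ^ k" using assms by (intro power_strict_mono) auto
  have 2: "d ^ k \<le> t ^ k" using assms by (intro power_mono) auto
  have 3: "t ^ k = d ^ k \<longleftrightarrow> t = d" using assms by (intro power_eq_iff_eq_base) auto
  have "0 \<le> (t ^ k - d ^ k) * (t ^ k - e ^ k)" using 1 2 by simp
  then show "t ^ (2 * k) - d ^ k * t ^ k \<ge> e ^ k * (t ^ k - d ^ k)" using eq by linarith
  have "t ^ (2 * k) - d ^ k * t ^ k = e ^ k * (t ^ k - d ^ k) \<longleftrightarrow> (t ^ k - d ^ k) * (t ^ k - e ^ k) = 0"
    using eq by linarith
  then show "t ^ (2 * k) - d ^ k * t ^ k = e ^ k * (t ^ k - d ^ k) \<longleftrightarrow> t = d"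
    using 1 3 by simp
qed

theorem theorem4:
  fixes \<Gamma> \<Gamma>_reg :: "(real^2) list" and c :: "real^2"
    and n \<alpha> :: nat and R L A A_star d :: real
  assumes "R > 0"
    and "convex_polygon \<Gamma>" and "length \<Gamma> = n" and "circumscribed_about \<Gamma> c R"
    and "L = perimeter \<Gamma>" and "A = area \<Gamma>"
    and "regular_polygon \<Gamma>_reg" and "length \<Gamma>_reg = n" and "circumscribed_about \<Gamma>_reg c R"
    and "A_star = area \<Gamma>_reg"
    and "d = real n * tan (pi / real n)"
    and "\<alpha> > 0"
  shows "(L ^ (2 * \<alpha>) - 4 ^ \<alpha> * (d * A) ^ \<alpha>
           \<ge> 4 ^ \<alpha> * tan (pi / real n) ^ \<alpha> * (A ^ \<alpha> - A_star ^ \<alpha>)) \<and>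
     (L ^ (2 * \<alpha>) - 4 ^ \<alpha> * (d * A) ^ \<alpha>
           = 4 ^ \<alpha> * tan (pi / real n) ^ \<alpha> * (A ^ \<alpha> - A_star ^ \<alpha>)
         \<longleftrightarrow> regular_polygon \<Gamma>) \<and>
     ((A / R\<^sup>2) ^ (2 * \<alpha>) - d ^ \<alpha> * (L / (2 * R)) ^ \<alpha>
           \<ge> tan (pi / real n) ^ \<alpha> * ((A / R\<^sup>2) ^ \<alpha> - (A_star / R\<^sup>2) ^ \<alpha>)) \<and>
     ((A / R\<^sup>2) ^ (2 * \<alpha>) - d ^ \<alpha> * (L / (2 * R)) ^ \<alpha>
           = tan (pi / real n) ^ \<alpha> * ((A / R\<^sup>2) ^ \<alpha> - (A_star / R\<^sup>2) ^ \<alpha>)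
         \<longleftrightarrow> regular_polygon \<Gamma>)"
proof -
  interpret G: tangential_polygon \<Gamma> c R using assms by unfold_locales auto
  interpret reg: tangential_polygon \<Gamma>_reg c R
    using assms by unfold_locales (auto simp: regular_polygon_def)
  define t e where "t = L / (2 * R)" and "e = tan (pi / n)"
  have n: "3 \<le> n" using G.n assms(3) by simp
  have e: "0 < e" unfolding e_def using n by (intro tan_gt_zero) (auto simp: field_simps)
  have ed: "e < d" using e n assms(11) by (simp add: e_def)
  have L: "L = 2 * R * t" using assms(1) by (simp add: t_def)
  have A: "A = R\<^sup>2 * t" using G.area_eq L assms(5,6) by (simp add: power2_eq_square)
  \<comment> \<open>The regular polygon is the equality case of the perimeter bound.\<close>
  have "perimeter \<Gamma>_reg = 2 * R * d" using reg.perimeter_eq_iff assms(7,8,11) by simp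
  then have A_star: "A_star = R\<^sup>2 * d" using reg.area_eq assms(10) by (simp add: power2_eq_square)
  have "2 * R * d \<le> 2 * R * t" "2 * R * t = 2 * R * d \<longleftrightarrow> regular_polygon \<Gamma>"
    using G.perimeter_ge G.perimeter_eq_iff unfolding assms(3) L[symmetric] assms(5,11) by simp_all
  then have td: "d \<le> t" "t = d \<longleftrightarrow> regular_polygon \<Gamma>" using assms(1) by simp_all
  \<comment> \<open>With \<open>L = 2 * R * t\<close> and \<open>A = R\<^sup>2 * t\<close>, both
    sides of the first inequality are \<open>K\<close> times those of the second, so both reduce to
    \<open>power_inequality\<close>.\<close>
  define K where "K = (4 * R\<^sup>2) ^ \<alpha>"
  have K: "0 < K" using assms(1) by (simp add: K_def)
  have lhs: "L ^ (2 * \<alpha>) - 4 ^ \<alpha> * (d * A) ^ \<alpha> = K * (t ^ (2 * \<alpha>) - d ^ \<alpha> * t ^ \<alpha>)"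
  proof -
    have "L ^ (2 * \<alpha>) = (4 * R\<^sup>2 * t\<^sup>2) ^ \<alpha>"
      by (simp only: L power_mult power_mult_distrib) simp
    moreover have "\<dots> = K * t ^ (2 * \<alpha>)"
      by (simp only: K_def power_mult power_mult_distrib)
    moreover have "4 ^ \<alpha> * (d * A) ^ \<alpha> = K * (d ^ \<alpha> * t ^ \<alpha>)"
      by (simp only: A K_def power_mult_distrib mult_ac)
    ultimately show ?thesis by (simp only: right_diff_distrib)
  qed
  have rhs: "4 ^ \<alpha> * e ^ \<alpha> * (A ^ \<alpha> - A_star ^ \<alpha>) = K * (e ^ \<alpha> * (t ^ \<alpha> - d ^ \<alpha>))"
    unfolding A A_star K_def power_mult_distrib by (simp only: right_diff_distrib left_diff_distrib mult_ac)
  have scaled: "A / R\<^sup>2 = t" "A_star / R\<^sup>2 = d" using A A_star assms(1) by auto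
  show ?thesis
    using power_inequality[OF less_imp_le[OF e] ed td(1) assms(12)] td(2) K
    unfolding e_def[symmetric] t_def[symmetric] lhs rhs scaled
    by (simp only: mult_le_cancel_left_pos mult_cancel_left) simp
qed

end
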